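(* Let $q\ge 19$ be an odd prime. For an integer $\overline{H}$, let $\mathcal{P}_{\overline{H}}=\{(0,1,0)\}\cup\{(1,i,i^2): i=0,1,\dots,\overline{H}\}$, and let $\overline{H}_q$ be the smallest integer $\overline{H}$ such that every point $(1,a,b)$ with $a,b\in F_q$, $b\neq a^2$, lies on a bisecant of $\mathcal{P}_{\overline{H}}$. Assume $\overline{H}_q\le (q-1)/2$ and let $H$ be an integer with $\max\{\overline{H}_q,\lfloor (q-1)/3\rfloor\}\le H\le (q-1)/2$. Let $\mathcal{K}_H=\{(1,i,i^2): i=0,\dots,H\}\cup\{(0,1,0),(0,1,b_H)\}$ where $b_H=2H+1$ if $H=\lfloor (q-1)/3\rfloor$ and $b_H=2H$ otherwise. Then $\mathcal{K}_H$ is a complete arc in $PG(2,q)$.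
   Context: Points of $PG(2,q)$ are in homogeneous coordinates $(x_0,x_1,x_2)$; integers are read in $F_q$. A bisecant of a point set is a line through two of its distinct points. An arc is a set of points no three collinear; it is complete if it is not contained in a larger arc. *)

theory Defs
  imports "HOL-Analysis.Cartesian_Space" "HOL-Computational_Algebra.Primes"
begin

(* PG(2,F) for a field F = 'a: points and lines are the one- and two-dimensional
   subspaces of F^3, incidence is inclusion. *)

type_synonym 'a subsp = "('a ^ 3) set"

definition is_point :: "('a::field) subsp \<Rightarrow> bool" where
  "is_point P \<longleftrightarrow> vec.subspace P \<and> vec.dim P = 1"

definition is_line :: "('a::field) subsp \<Rightarrow> bool" where
  "is_line L \<longleftrightarrow> vec.subspace L \<and> vec.dim L = 2"

(* Only a point when the coordinates are not all zero. *)
definition pt :: "'a::field \<Rightarrow> 'a \<Rightarrow> 'a \<Rightarrow> 'a subsp" where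
  "pt x0 x1 x2 = vec.span {vector [x0, x1, x2]}"

definition bisecant :: "('a::field) subsp set \<Rightarrow> 'a subsp \<Rightarrow> bool" where
  "bisecant S L \<longleftrightarrow> is_line L \<and> (\<exists>P\<in>S. \<exists>Q\<in>S. P \<noteq> Q \<and> P \<subseteq> L \<and> Q \<subseteq> L)"

definition collinear3 :: "('a::field) subsp \<Rightarrow> 'a subsp \<Rightarrow> 'a subsp \<Rightarrow> bool" where
  "collinear3 P Q R \<longleftrightarrow> (\<exists>L. is_line L \<and> P \<subseteq> L \<and> Q \<subseteq> L \<and> R \<subseteq> L)"

definition is_arc :: "('a::field) subsp set \<Rightarrow> bool" where
  "is_arc S \<longleftrightarrow> (\<forall>P\<in>S. is_point P) \<and>
     (\<forall>P\<in>S. \<forall>Q\<in>S. \<forall>R\<in>S. P \<noteq> Q \<and> P \<noteq> R \<and> Q \<noteq> R \<longrightarrow> \<not> collinear3 P Q R)"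

definition complete_arc :: "('a::field) subsp set \<Rightarrow> bool" where
  "complete_arc S \<longleftrightarrow> is_arc S \<and> \<not> (\<exists>T. is_arc T \<and> S \<subset> T)"

definition conic_pts :: "nat \<Rightarrow> ('a::field) subsp set" where
  "conic_pts H = {pt 1 (of_nat i) ((of_nat i)\<^sup>2) | i. i \<in> {0..H}}"

definition P_set :: "nat \<Rightarrow> ('a::field) subsp set" where
  "P_set H = {pt 0 1 0} \<union> conic_pts H"

definition covers_off_conic :: "'a::field itself \<Rightarrow> nat \<Rightarrow> bool" where
  "covers_off_conic _ H \<longleftrightarrow>
     (\<forall>a b::'a. b \<noteq> a\<^sup>2 \<longrightarrow> (\<exists>L. bisecant (P_set H) L \<and> pt 1 a b \<subseteq> L))"

(* The least integer with this property is a natural number: for H < 0 the set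
   is the single point (0,1,0), which has no bisecant. *)
definition H_bar :: "'a::field itself \<Rightarrow> nat" where
  "H_bar F = (LEAST H. covers_off_conic F H)"

definition b_coef :: "nat \<Rightarrow> nat \<Rightarrow> nat" where
  "b_coef q H = (if H = (q - 1) div 3 then 2 * H + 1 else 2 * H)"

definition K_set :: "nat \<Rightarrow> nat \<Rightarrow> ('a::field) subsp set" where
  "K_set q H = conic_pts H \<union> {pt 0 1 0, pt 0 1 (of_nat (b_coef q H))}"

end

theory Submission
  imports Defs "HOL-Number_Theory.Residues"
begin

text \<open>
  The points \<open>(1,i,i\<^sup>2)\<close>, \<open>(1,j,j\<^sup>2)\<close> and \<open>(0,1,m)\<close> with \<open>i \<noteq> j\<close> are collinear iff \<open>m = i + j\<close>.
  For \<open>0 \<le> i < j \<le> H\<close> the sum \<open>i + j\<close> lies between \<open>1\<close> and \<open>2H - 1 \<le> q - 2\<close>, so it is neither \<open>0\<close>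
  nor \<open>b\<^sub>H\<close>, and the set is an arc. It is complete: the line joining \<open>(0,1,0)\<close> and \<open>(0,1,b\<^sub>H)\<close> is
  the whole line at infinity; affine points off the conic are covered by the choice of \<open>H\<close>; and
  the conic points with parameter in \<open>{q-H..q-1}\<close> and \<open>{b\<^sub>H-H..b\<^sub>H}\<close> lie on chords through
  \<open>(0,1,0)\<close> and \<open>(0,1,b\<^sub>H)\<close>, these ranges together containing \<open>{H+1..q-1}\<close> because
  \<open>H \<ge> \<lfloor>(q-1)/3\<rfloor>\<close> and \<open>3\<close> does not divide \<open>q\<close>.
\<close>

section \<open>Points and lines in coordinates\<close>

lemma vector_3_eq_iff:
  "(v :: 'a::zero ^ 3) = vector [x, y, z] \<longleftrightarrow> v $ 1 = x \<and> v $ 2 = y \<and> v $ 3 = z"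
  by (auto simp: vec_eq_iff forall_3)

lemma mem_pt_iff: "v \<in> pt x y z \<longleftrightarrow> (\<exists>k. v = vector [k * x, k * y, k * z])"
  by (auto simp: pt_def vec.span_singleton vec_eq_iff forall_3 image_iff)

lemma pt_subset_iff:
  assumes "vec.subspace L"
  shows "pt x y z \<subseteq> L \<longleftrightarrow> vector [x, y, z] \<in> L"
  unfolding pt_def using assms
  by (meson vec.span_base vec.span_minimal empty_subsetI insert_subset singletonI subsetD)

lemma pt_eqD:
  assumes "pt x y z = pt x' y' z'"
  obtains k where "x = k * x'" "y = k * y'" "z = k * z'"
proof -
  have "vector [x, y, z] \<in> pt x y z"
    by (simp add: pt_def vec.span_base)
  then show ?thesis
    using that unfolding assms mem_pt_iff by (auto simp: vector_3_eq_iff)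
qed

lemma pt_affine_eq_iff: "pt 1 a b = pt 1 c d \<longleftrightarrow> a = c \<and> b = d"
  by (auto elim!: pt_eqD)

lemma pt_infinite_eq_iff: "pt 0 1 a = pt 0 1 b \<longleftrightarrow> a = b"
  by (auto elim!: pt_eqD)

lemma pt_affine_neq_infinite: "pt 1 a b \<noteq> pt 0 c d"
  by (auto elim!: pt_eqD)

lemma is_point_pt:
  assumes "x \<noteq> 0 \<or> y \<noteq> 0 \<or> z \<noteq> 0"
  shows "is_point (pt x y z)"
proof -
  have "(vector [x, y, z] :: 'a ^ 3) \<noteq> 0"
    using assms by (auto simp: vec_eq_iff forall_3)
  then have "vec.independent {vector [x, y, z] :: 'a ^ 3}"
    by simp
  from vec.dim_span_eq_card_independent[OF this] show ?thesis
    by (simp add: is_point_def pt_def)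
qed

text \<open>Dividing a spanning vector by its first coordinate gives the affine form; if that
  coordinate is 0, the point lies at infinity.\<close>

lemma is_point_cases:
  assumes "is_point P"
  obtains (affine) a b where "P = pt 1 a b" | (infinite) a b where "P = pt 0 a b"
proof -
  obtain B where B: "B \<subseteq> P" "P \<subseteq> vec.span B" "card B = vec.dim P"
    by (rule vec.basis_exists[of P])
  with assms obtain v where v: "B = {v}"
    by (auto simp: is_point_def card_1_singleton_iff)
  have "P = vec.span {v}"
    using assms B v by (metis is_point_def subset_antisym vec.span_minimal)
  also have "{v} = {vector [v $ 1, v $ 2, v $ 3]}"
    by (auto simp: vec_eq_iff forall_3)
  finally have P: "P = pt (v $ 1) (v $ 2) (v $ 3)"
    by (simp add: pt_def)
  show ?thesis
  proof (cases "v $ 1 = 0")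
    case True
    with P show ?thesis using infinite by simp
  next
    case False
    have "P = pt 1 (v $ 2 / v $ 1) (v $ 3 / v $ 1)"
    proof (intro Set.set_eqI iffI)
      fix w assume "w \<in> P"
      then obtain k where "w = vector [k * v $ 1, k * v $ 2, k * v $ 3]"
        unfolding P mem_pt_iff by blast
      then show "w \<in> pt 1 (v $ 2 / v $ 1) (v $ 3 / v $ 1)"
        unfolding mem_pt_iff using False by (intro exI[of _ "k * v $ 1"]) simp
    next
      fix w assume "w \<in> pt 1 (v $ 2 / v $ 1) (v $ 3 / v $ 1)"
      then obtain k where "w = vector [k * 1, k * (v $ 2 / v $ 1), k * (v $ 3 / v $ 1)]"
        unfolding mem_pt_iff by blast
      then show "w \<in> P"
        unfolding P mem_pt_iff using False by (intro exI[of _ "k / v $ 1"]) simp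
    qed
    then show ?thesis by (rule affine)
  qed
qed

section \<open>Lines as spans of two vectors and by explicit equations\<close>

lemma is_line_span2:
  assumes "u \<notin> vec.span {v}" "v \<noteq> 0"
  shows "is_line (vec.span {u, v})"
proof -
  have "vec.independent {u, v}"
    using assms by (simp add: vec.independent_insert)
  moreover have "u \<noteq> v"
    using assms by (auto simp: vec.span_base)
  ultimately show ?thesis
    by (simp add: is_line_def vec.dim_eq_card_independent)
qed

text \<open>These are the lines missing (0,0,1). The slope \<open>m\<close> can be read off at
  infinity, where the line has the point (0,1,m).\<close>

definition affine_line :: "'a::field \<Rightarrow> 'a \<Rightarrow> 'a subsp" where
  "affine_line m c = {v. v $ 3 = m * v $ 2 + c * v $ 1}"

definition infinite_line :: "('a::field) subsp" where
  "infinite_line = {v. v $ 1 = 0}"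

lemma affine_line_eq_span: "affine_line m c = vec.span {vector [0, 1, m], vector [1, 0, c]}"
proof (intro Set.set_eqI)
  fix v :: "'a ^ 3"
  show "v \<in> affine_line m c \<longleftrightarrow> v \<in> vec.span {vector [0, 1, m], vector [1, 0, c]}"
    by (auto simp: affine_line_def vec.span_breakdown_eq vec.span_singleton image_iff
        vec_eq_iff forall_3 algebra_simps)
qed

lemma infinite_line_eq_span: "infinite_line = vec.span {vector [0, 1, 0], vector [0, 0, 1]}"
proof (intro Set.set_eqI)
  fix v :: "'a ^ 3"
  show "v \<in> infinite_line \<longleftrightarrow> v \<in> vec.span {vector [0, 1, 0], vector [0, 0, 1]}"
    by (auto simp: infinite_line_def vec.span_breakdown_eq vec.span_singleton image_iff
        vec_eq_iff forall_3 algebra_simps)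
qed

lemma is_line_affine_line: "is_line (affine_line m c)"
  unfolding affine_line_eq_span
  by (rule is_line_span2) (auto simp: vec.span_singleton vec_eq_iff forall_3)

lemma is_line_infinite_line: "is_line infinite_line"
  unfolding infinite_line_eq_span
  by (rule is_line_span2) (auto simp: vec.span_singleton vec_eq_iff forall_3)

lemma pt_subset_affine_line_iff: "pt x y z \<subseteq> affine_line m c \<longleftrightarrow> z = m * y + c * x"
  using is_line_affine_line[of m c]
  by (simp add: is_line_def pt_subset_iff) (simp add: affine_line_def)

lemma pt_subset_infinite_line_iff: "pt x y z \<subseteq> (infinite_line :: 'a::field subsp) \<longleftrightarrow> x = 0"
  using is_line_infinite_line[where 'a = 'a]
  by (simp add: is_line_def pt_subset_iff) (simp add: infinite_line_def)

lemma is_line_eq_span: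
  assumes "is_line L"
  obtains u v where "L = vec.span {u, v}"
proof -
  obtain B where B: "B \<subseteq> L" "L \<subseteq> vec.span B" "card B = vec.dim L"
    by (rule vec.basis_exists[of L])
  with assms obtain u v where "B = {u, v}"
    by (auto simp: is_line_def card_2_iff)
  moreover have "L = vec.span B"
    using assms B by (metis is_line_def subset_antisym vec.span_minimal)
  ultimately show ?thesis using that by simp
qed

text \<open>Three vectors in the span of two are dependent, so their determinant vanishes. This is
  the tool for refuting collinearity.\<close>

lemma collinear3_pt_imp_det_eq_0:
  assumes "collinear3 (pt a0 a1 a2) (pt b0 b1 b2) (pt c0 c1 c2)"
  shows "a0 * (b1 * c2 - b2 * c1) - a1 * (b0 * c2 - b2 * c0) + a2 * (b0 * c1 - b1 * c0) = 0"
proof -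
  obtain L where L: "is_line L"
    "pt a0 a1 a2 \<subseteq> L" "pt b0 b1 b2 \<subseteq> L" "pt c0 c1 c2 \<subseteq> L"
    using assms by (auto simp: collinear3_def)
  obtain u v where uv: "L = vec.span {u, v}"
    using is_line_eq_span[OF L(1)] .
  have comb: "\<exists>k l. x = k * u $ 1 + l * v $ 1 \<and> y = k * u $ 2 + l * v $ 2 \<and> z = k * u $ 3 + l * v $ 3"
    if "pt x y z \<subseteq> L" for x y z
  proof -
    have "vector [x, y, z] \<in> vec.span {u, v}"
      using that L(1) uv by (simp add: pt_subset_iff is_line_def)
    then obtain k l where "vector [x, y, z] - k *s u = l *s v"
      by (auto simp: vec.span_breakdown_eq vec.span_singleton)
    then have "vector [x, y, z] = k *s u + l *s v"
      by (simp add: algebra_simps)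
    then show ?thesis
      by (auto simp: vec_eq_iff forall_3)
  qed
  \<comment> \<open>With all nine coordinates written as combinations of \<open>u\<close> and
    \<open>v\<close>, the determinant cancels identically.\<close>
  from comb[OF L(2)] comb[OF L(3)] comb[OF L(4)] show ?thesis
    by (elim exE conjE) (hypsubst_thin, simp add: algebra_simps)
qed

section \<open>Arcs\<close>

text \<open>Collinearity is symmetric, so any new triple can be permuted to put \<open>P\<close>
  first.\<close>

lemma is_arc_insert:
  assumes "is_arc S" "is_point P"
    and "\<And>Q R. Q \<in> S \<Longrightarrow> R \<in> S \<Longrightarrow> Q \<noteq> R \<Longrightarrow> \<not> collinear3 P Q R"
  shows "is_arc (insert P S)"
proof -
  have "\<not> collinear3 Q P R" "\<not> collinear3 Q R P" if "Q \<in> S" "R \<in> S" "Q \<noteq> R" for Q R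
    using assms(3)[OF that] by (auto simp: collinear3_def)
  with assms show ?thesis
    unfolding is_arc_def by auto
qed

text \<open>A strictly larger arc would contain a point \<open>R\<close> outside \<open>S\<close>; a
  bisecant of \<open>S\<close> through \<open>R\<close> then carries three points of that
  arc.\<close>

lemma complete_arcI:
  assumes "is_arc S"
    and "\<And>R. is_point R \<Longrightarrow> R \<notin> S \<Longrightarrow> \<exists>L. bisecant S L \<and> R \<subseteq> L"
  shows "complete_arc S"
  unfolding complete_arc_def
proof (intro conjI notI)
  assume "\<exists>T. is_arc T \<and> S \<subset> T"
  then obtain T R where T: "is_arc T" "S \<subseteq> T" "R \<in> T" "R \<notin> S"
    by blast
  then obtain L where "bisecant S L" "R \<subseteq> L"
    using assms(2)[of R] by (auto simp: is_arc_def)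
  then obtain P Q where PQ: "P \<in> S" "Q \<in> S" "P \<noteq> Q" "collinear3 P Q R"
    by (auto simp: bisecant_def collinear3_def)
  with T(2,4) have "P \<in> T" "Q \<in> T" "P \<noteq> R" "Q \<noteq> R"
    by auto
  with T(1,3) PQ show False
    unfolding is_arc_def by metis
qed (fact assms(1))

section \<open>Bisecants and chords of the conic\<close>

lemma bisecant_mono:
  assumes "bisecant S L" "S \<subseteq> T"
  shows "bisecant T L"
  using assms unfolding bisecant_def by blast

text \<open>The equation \<open>(X - s) * (X - t) = 0\<close> reads X^2 = (s + t) X - s t, which
  gives slope and intercept of the chord; for \<open>s = t\<close> the line is the tangent.\<close>

lemma conic_chord:
  fixes s t :: "'a::field"
  shows "pt 1 s (s\<^sup>2) \<subseteq> affine_line (s + t) (- (s * t))"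
    and "pt 1 t (t\<^sup>2) \<subseteq> affine_line (s + t) (- (s * t))"
    and "pt 0 1 (s + t) \<subseteq> affine_line (s + t) (- (s * t))"
  by (simp_all add: pt_subset_affine_line_iff power2_eq_square algebra_simps)

text \<open>The determinant of the three points factors as
  \<open>(t - s) * (m - (s + t))\<close>.\<close>

lemma conic_collinear3_infinite:
  fixes s t m :: "'a::field"
  assumes "collinear3 (pt 0 1 m) (pt 1 s (s\<^sup>2)) (pt 1 t (t\<^sup>2))" "s \<noteq> t"
  shows "m = s + t"
proof -
  have "(t - s) * (m - (s + t)) = 0"
    using collinear3_pt_imp_det_eq_0[OF assms(1)] by (simp add: power2_eq_square algebra_simps)
  with assms(2) show ?thesis by simp
qed

text \<open>The determinant is of Vandermonde type, a product of differences of the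
  parameters.\<close>

lemma conic_not_collinear3:
  fixes r s t :: "'a::field"
  assumes "r \<noteq> s" "r \<noteq> t" "s \<noteq> t"
  shows "\<not> collinear3 (pt 1 r (r\<^sup>2)) (pt 1 s (s\<^sup>2)) (pt 1 t (t\<^sup>2))"
proof
  assume "collinear3 (pt 1 r (r\<^sup>2)) (pt 1 s (s\<^sup>2)) (pt 1 t (t\<^sup>2))"
  from collinear3_pt_imp_det_eq_0[OF this] have "(s - r) * ((t - r) * (t - s)) = 0"
    by (simp add: power2_eq_square algebra_simps)
  with assms show False by simp
qed

lemma is_arc_conic_pts: "is_arc (conic_pts H)"
  unfolding is_arc_def
proof (intro conjI ballI impI)
  fix P :: "'a subsp" assume "P \<in> conic_pts H"
  then show "is_point P"
    by (auto simp: conic_pts_def intro!: is_point_pt)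
next
  fix P Q R :: "'a subsp"
  assume "P \<in> conic_pts H" "Q \<in> conic_pts H" "R \<in> conic_pts H" "P \<noteq> Q \<and> P \<noteq> R \<and> Q \<noteq> R"
  moreover from this obtain i j k where
    "P = pt 1 (of_nat i) ((of_nat i)\<^sup>2)" "Q = pt 1 (of_nat j) ((of_nat j)\<^sup>2)"
    "R = pt 1 (of_nat k) ((of_nat k)\<^sup>2)"
    by (auto simp: conic_pts_def)
  ultimately show "\<not> collinear3 P Q R"
    by (metis conic_not_collinear3)
qed

lemma conic_ptsI: "i \<le> H \<Longrightarrow> pt 1 (of_nat i) ((of_nat i)\<^sup>2) \<in> conic_pts H"
  by (auto simp: conic_pts_def)

lemma conic_ptsE:
  assumes "P \<in> conic_pts H"
  obtains i where "i \<le> H" "P = pt 1 (of_nat i) ((of_nat i)\<^sup>2)"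
  using assms by (auto simp: conic_pts_def)

text \<open>By \<open>slopes\<close>, no chord of the conic points has slope \<open>0\<close> or
  \<open>b\<close>, so the two points at infinity can be adjoined one after the other.\<close>

lemma is_arc_conic_two_infinite:
  fixes b :: "'a::field"
  assumes "b \<noteq> 0"
    and slopes: "\<And>i j. i < j \<Longrightarrow> j \<le> H \<Longrightarrow> of_nat (i + j) \<noteq> (0 :: 'a) \<and> of_nat (i + j) \<noteq> b"
  shows "is_arc (conic_pts H \<union> {pt 0 1 0, pt 0 1 b})"
proof -
  have chord: "\<not> collinear3 (pt 0 1 m) Q R"
    if QR: "Q \<in> conic_pts H" "R \<in> conic_pts H" "Q \<noteq> R" and m: "m = 0 \<or> m = b" for m :: 'a and Q R
  proof
    assume col: "collinear3 (pt 0 1 m) Q R"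
    obtain i j where i: "i \<le> H" "Q = pt 1 (of_nat i) ((of_nat i)\<^sup>2)"
      and j: "j \<le> H" "R = pt 1 (of_nat j) ((of_nat j)\<^sup>2)"
      using QR by (elim conic_ptsE)
    with QR have "(of_nat i :: 'a) \<noteq> of_nat j" by auto
    with col i j have "m = of_nat (i + j)"
      using conic_collinear3_infinite by fastforce
    moreover have "i < j \<or> j < i"
      using QR i j by force
    ultimately show False
      using slopes[of i j] slopes[of j i] m i(1) j(1) by (auto simp: add.commute)
  qed
  have mixed: "\<not> collinear3 (pt 0 1 b) (pt 0 1 0) Q" if Q: "Q \<in> conic_pts H" for Q :: "'a subsp"
  proof
    assume col: "collinear3 (pt 0 1 b) (pt 0 1 0) Q"
    obtain i where "Q = pt 1 (of_nat i) ((of_nat i)\<^sup>2)"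
      using Q by (rule conic_ptsE)
    \<comment> \<open>The determinant of these three points is \<open>-b\<close>, whatever
      \<open>i\<close> is.\<close>
    with collinear3_pt_imp_det_eq_0 col have "b * (0 - 1) = 0" by fastforce
    with assms(1) show False by simp
  qed
  then have mixed': "\<not> collinear3 (pt 0 1 b) Q (pt 0 1 0)" if "Q \<in> conic_pts H" for Q :: "'a subsp"
    using that by (auto simp: collinear3_def)
  have "is_arc (insert (pt 0 1 b) (insert (pt 0 1 0) (conic_pts H)))"
    using chord mixed mixed' by (intro is_arc_insert is_arc_conic_pts is_point_pt) auto
  also have "insert (pt 0 1 b) (insert (pt 0 1 0) (conic_pts H)) = conic_pts H \<union> {pt 0 1 0, pt 0 1 b}"
    by auto
  finally show ?thesis .
qed

section \<open>Prime fields\<close>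

text \<open>The characteristic divides the cardinality and is not 1, so primality leaves one
  value.\<close>

lemma CHAR_eq_prime_CARD:
  assumes "prime (CARD('a::{field,finite}))"
  shows "CHAR('a) = CARD('a)"
  using assms CHAR_dvd_CARD[where 'a = 'a] CHAR_not_1[where 'a = 'a]
  by (auto simp: prime_nat_iff)

text \<open>The naturals below \<open>CARD('a)\<close> are pairwise incongruent modulo the
  characteristic, so by counting their images exhaust the field.\<close>

lemma surj_of_nat_prime_field:
  fixes a :: "'a::{field,finite}"
  assumes "prime (CARD('a))"
  obtains i where "i < CARD('a)" "a = of_nat i"
proof -
  have "inj_on (of_nat :: nat \<Rightarrow> 'a) {..<CARD('a)}"
    by (auto simp: inj_on_def of_nat_eq_iff_cong_CHAR CHAR_eq_prime_CARD[OF assms] cong_def)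
  then have "card ((of_nat :: nat \<Rightarrow> 'a) ` {..<CARD('a)}) = CARD('a)"
    by (simp add: card_image)
  then have "(of_nat :: nat \<Rightarrow> 'a) ` {..<CARD('a)} = UNIV"
    by (intro card_subset_eq) auto
  then have "a \<in> of_nat ` {..<CARD('a)}" by simp
  with that show ?thesis by auto
qed

text \<open>
  The chord through parameters \<open>s\<close> and \<open>t\<close> passes through \<open>(1,a,b)\<close> iff
  \<open>(a - s) (a - t) = a\<^sup>2 - b\<close>; factor \<open>a\<^sup>2 - b\<close> as \<open>1 \<cdot> (a\<^sup>2 - b)\<close>, or as \<open>2 \<cdot> (1/2)\<close> if it equals \<open>1\<close>.
\<close>

lemma off_conic_on_chord:
  fixes a b :: "'a::field"
  assumes "b \<noteq> a\<^sup>2" "(2 :: 'a) \<noteq> 0" "(3 :: 'a) \<noteq> 0"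
  obtains s t where "s \<noteq> t" "pt 1 a b \<subseteq> affine_line (s + t) (- (s * t))"
proof (cases "a\<^sup>2 - b = 1")
  case True
  define h :: 'a where "h = 1 / 2"
  have h: "2 * h = 1"
    using assms(2) by (simp add: h_def)
  have "a - 2 \<noteq> a - h"
  proof
    assume "a - 2 = a - h"
    \<comment> \<open>Here \<open>h = 2\<close>, so \<open>2 * h = 1\<close> says 4 = 1; in this
      form cancelling 1 leaves 3 = 0.\<close>
    with h have "(3 :: 'a) + 1 = 0 + 1" by simp
    with assms(3) show False by (simp only: add_right_cancel)
  qed
  moreover have "b = (a - 2 + (a - h)) * a - (a - 2) * (a - h)"
  proof -
    have "b = a\<^sup>2 - 2 * h"
      unfolding h True[symmetric] by simp
    also have "\<dots> = (a - 2 + (a - h)) * a - (a - 2) * (a - h)"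
      by (simp add: algebra_simps power2_eq_square)
    finally show ?thesis .
  qed
  ultimately show ?thesis
    using that[of "a - 2" "a - h"] by (simp add: pt_subset_affine_line_iff)
next
  case False
  then have "a - 1 \<noteq> a - (a\<^sup>2 - b)" by (metis diff_diff_eq2 add_diff_cancel_left')
  moreover have "b = (a - 1 + (a - (a\<^sup>2 - b))) * a - (a - 1) * (a - (a\<^sup>2 - b))"
    by (simp add: algebra_simps power2_eq_square)
  ultimately show ?thesis
    using that[of "a - 1" "a - (a\<^sup>2 - b)"] by (simp add: pt_subset_affine_line_iff)
qed

text \<open>This makes the minimum in \<open>H_bar\<close> one over a nonempty set: with bound
  \<open>CARD('a)\<close> all affine conic points are present, so every chord is a bisecant.\<close>

lemma covers_off_conic_CARD:
  assumes "prime (CARD('a::{field,finite}))" "CARD('a) > 3"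
  shows "covers_off_conic TYPE('a) (CARD('a))"
  unfolding covers_off_conic_def
proof (intro allI impI)
  fix a b :: 'a assume "b \<noteq> a\<^sup>2"
  moreover have "of_nat 2 \<noteq> (0 :: 'a)" "of_nat 3 \<noteq> (0 :: 'a)"
    using assms unfolding of_nat_eq_0_iff_char_dvd
    by (simp_all add: CHAR_eq_prime_CARD nat_dvd_not_less)
  ultimately obtain s t where st: "s \<noteq> t" "pt 1 a b \<subseteq> affine_line (s + t) (- (s * t))"
    using off_conic_on_chord[of b a] by auto
  have mem: "pt 1 x (x\<^sup>2) \<in> P_set (CARD('a))" for x :: 'a
    using surj_of_nat_prime_field[OF assms(1), of x] conic_ptsI
    unfolding P_set_def by (metis UnI2 less_imp_le)
  have "bisecant (P_set (CARD('a))) (affine_line (s + t) (- (s * t)))"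
    unfolding bisecant_def using is_line_affine_line mem conic_chord(1,2) st(1)
    by (metis pt_affine_eq_iff)
  with st(2) show "\<exists>L. bisecant (P_set (CARD('a))) L \<and> pt 1 a b \<subseteq> L" by blast
qed

lemma covers_off_conic_mono:
  assumes "covers_off_conic TYPE('a::field) G" "G \<le> H"
  shows "covers_off_conic TYPE('a) H"
proof -
  have "(P_set G :: 'a subsp set) \<subseteq> P_set H"
    using assms(2) by (auto simp: P_set_def conic_pts_def)
  with assms(1) show ?thesis
    unfolding covers_off_conic_def by (meson bisecant_mono)
qed

section \<open>The complete arc\<close>

theorem theorem11:
  fixes q H :: nat
  assumes "prime q" and "odd q" and "q \<ge> 19"
    and "CARD('a::{field,finite}) = q"
    and "H_bar TYPE('a) \<le> (q - 1) div 2"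
    and "max (H_bar TYPE('a)) ((q - 1) div 3) \<le> H"
    and "H \<le> (q - 1) div 2"
  shows "complete_arc (K_set q H :: 'a subsp set)"
proof (rule complete_arcI)
  define b where "b = b_coef q H"
  have CHAR: "CHAR('a) = q"
    using CHAR_eq_prime_CARD[where 'a = 'a] assms by simp
  have nz: "of_nat n \<noteq> (0 :: 'a)" if "0 < n" "n < q" for n
    using that by (simp add: of_nat_eq_0_iff_char_dvd CHAR nat_dvd_not_less)
  have neq: "of_nat m \<noteq> (of_nat n :: 'a)" if "m \<noteq> n" "m < q" "n < q" for m n
    using that by (simp add: of_nat_eq_iff_cong_CHAR CHAR cong_def)
  have "\<not> 3 dvd q"
    using assms(1,3) by (auto simp: prime_nat_iff)
  have H: "2 * H < q" "(q - 1) div 3 \<le> H"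
    using assms(3,6,7) by auto
  \<comment> \<open>The last bound closes the gap between the ranges ending at \<open>b\<close> and
    starting at \<open>q - H\<close>. If \<open>H = (q - 1) div 3\<close>, it reads
    \<open>q \<le> 3 * H + 2\<close>, and only \<open>q = 3 * H + 3\<close> could violate it, which
    is where \<open>\<not> 3 dvd q\<close> enters.\<close>
  have b: "0 < b" "b < q" "2 * H \<le> b" "b \<le> 2 * H + 1" "q \<le> b + H + 1"
    using H assms(3) \<open>\<not> 3 dvd q\<close> unfolding b_def b_coef_def by (auto split: if_splits, presburger+)
  have K: "K_set q H = conic_pts H \<union> {pt 0 1 0, pt 0 1 (of_nat b :: 'a)}"
    by (simp add: K_set_def b_def)
  show "is_arc (K_set q H :: 'a subsp set)"
    unfolding K
  proof (rule is_arc_conic_two_infinite)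
    show "of_nat b \<noteq> (0 :: 'a)"
      using nz b by simp
    fix i j assume "i < j" "j \<le> H"
    then show "of_nat (i + j) \<noteq> (0 :: 'a) \<and> of_nat (i + j) \<noteq> (of_nat b :: 'a)"
      using H b by (intro conjI nz neq) auto
  qed

  have covers: "covers_off_conic TYPE('a) H"
  proof (rule covers_off_conic_mono)
    \<comment> \<open>A witness for \<open>LeastI\<close>, so that \<open>H_bar\<close> itself has
      the covering property.\<close>
    have "covers_off_conic TYPE('a) (CARD('a))"
      using assms by (intro covers_off_conic_CARD) auto
    then show "covers_off_conic TYPE('a) (H_bar TYPE('a))"
      unfolding H_bar_def by (rule LeastI)
  qed (use assms in simp)

  \<comment> \<open>The point with parameter \<open>x\<close> need not be in the set: the bisecant
    is spanned by the conic point \<open>j\<close> and the point at infinity of slope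
    \<open>x + j\<close>.\<close>
  have chord: "\<exists>L. bisecant (K_set q H) L \<and> pt 1 x (x\<^sup>2) \<subseteq> L"
    if "j \<le> H" "pt 0 1 (x + of_nat j) \<in> K_set q H" for x :: 'a and j
  proof (intro exI conjI)
    show "pt 1 x (x\<^sup>2) \<subseteq> affine_line (x + of_nat j) (- (x * of_nat j))"
      by (rule conic_chord)
    have "pt 1 (of_nat j) ((of_nat j)\<^sup>2) \<in> (K_set q H :: 'a subsp set)"
      unfolding K using conic_ptsI[OF that(1)] by blast
    with that(2) show "bisecant (K_set q H) (affine_line (x + of_nat j) (- (x * of_nat j)))"
      unfolding bisecant_def using is_line_affine_line conic_chord(2,3) pt_affine_neq_infinite by metis
  qed

  fix R :: "'a subsp"
  assume "is_point R" and R: "R \<notin> K_set q H"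
  from \<open>is_point R\<close> show "\<exists>L. bisecant (K_set q H) L \<and> R \<subseteq> L"
  proof (cases rule: is_point_cases)
    case (infinite x y)
    have "pt 0 1 0 \<noteq> pt 0 1 (of_nat b :: 'a)"
      using nz[of b] b by (simp add: pt_infinite_eq_iff)
    then have "bisecant (K_set q H) (infinite_line :: 'a subsp)"
      unfolding bisecant_def K using is_line_infinite_line pt_subset_infinite_line_iff by blast
    then show ?thesis
      unfolding infinite using pt_subset_infinite_line_iff by blast
  next
    case (affine x y)
    show ?thesis
    proof (cases "y = x\<^sup>2")
      case False
      have "P_set H \<subseteq> (K_set q H :: 'a subsp set)"
        by (auto simp: P_set_def K)
      with False covers show ?thesis
        unfolding affine covers_off_conic_def by (meson bisecant_mono)
    next
      case True
      obtain i where i: "i < q" "x = of_nat i"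
        using surj_of_nat_prime_field[of x] assms(1,4) by auto
      then have "H < i"
        using R conic_ptsI[of i H] affine True unfolding K by (metis UnI1 not_le)
      show ?thesis
      proof (cases "q \<le> i + H")
        case True
        \<comment> \<open>The partner \<open>q - i\<close> makes the slope 0, and the case
          assumption says that it is at most \<open>H\<close>.\<close>
        have "x + of_nat (q - i) = of_nat (i + (q - i))"
          using i by simp
        also have "\<dots> = 0"
          using i by (simp add: of_nat_eq_0_iff_char_dvd CHAR del: of_nat_add)
        finally have "pt 0 1 (x + of_nat (q - i)) \<in> K_set q H"
          by (simp add: K)
        with chord[of "q - i" x] True show ?thesis
          unfolding affine \<open>y = x\<^sup>2\<close> by simp
      next
        case False
        \<comment> \<open>The partner \<open>b - i\<close> makes the slope \<open>b\<close>. The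
          subtraction is not truncated, since \<open>i \<le> q - H - 1 \<le> b\<close>, and
          \<open>H < i\<close> with \<open>b \<le> 2 * H + 1\<close> gives
          \<open>b - i \<le> H\<close>.\<close>
        have "x + of_nat (b - i) = of_nat (i + (b - i))"
          using i by simp
        also have "i + (b - i) = b"
          using False b by simp
        finally have "pt 0 1 (x + of_nat (b - i)) \<in> K_set q H"
          by (simp add: K)
        with chord[of "b - i" x] b \<open>H < i\<close> show ?thesis
          unfolding affine \<open>y = x\<^sup>2\<close> by simp
      qed
    qed
  qed
qed

end
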